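(* For complex parameters $\beta_1,\beta_2$ define the birational map $R(\beta_1,\beta_2):(x,y)\mapsto(p,q)$, with $x=(x^1,x^2)$, $y=(y^1,y^2)$, $p=(p^1,p^2)$, $q=(q^1,q^2)$, by $$(p^1,p^2)=(y^1P^{-1},\;y^2P),\qquad (q^1,q^2)=\big(x^1P,\;x^2+y^2(1-P)\big),\qquad P=1+\frac{\beta_1-\beta_2}{x^1-y^2}.$$ Then: (a) whenever $u,v,u_{(1)},u_{(2)},v_{(2)},u_{(1,2)},v_{(1,2)}$ satisfy $$u_{(1,2)}=u+\frac{\beta_1-\beta_2}{1-u_{(1)}v_{(2)}}u_{(1)},\qquad v_{(1,2)}=v-\frac{\beta_1-\beta_2}{1-u_{(1)}v_{(2)}}v_{(2)},$$ the quantities $x=(u/u_{(1)},\,v\,u_{(1)})$, $y=(u_{(2)}/u,\,u\,v_{(2)})$, $p=(u_{(2)}/u_{(1,2)},\,v_{(2)}u_{(1,2)})$, $q=(u_{(1,2)}/u_{(1)},\,u_{(1)}v_{(1,2)})$ satisfy $(p,q)=R(\beta_1,\beta_2)(x,y)$; (b) $R$ satisfies the parameter-dependent Yang-Baxter relation $$R^{(2,3)}(\beta_2,\beta_3)\,R^{(1,3)}(\beta_1,\beta_3)\,R^{(1,2)}(\beta_1,\beta_2)=R^{(1,2)}(\beta_1,\beta_2)\,R^{(1,3)}(\beta_1,\beta_3)\,R^{(2,3)}(\beta_2,\beta_3).$$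
   Context: Upper indices on $x,y,p,q$ denote components, not powers (except $P^{-1}=1/P$). All variables are complex scalars; identities are understood for generic values, where all expressions are defined (equalities of rational maps). $R^{(i,j)}$ acts on triples $(x,y,z)$ of elements of $\mathbb{C}^2$ as $R$ on the $i$-th and $j$-th entries (in this order) and as the identity on the remaining entry; products are compositions. Subscripts in parentheses are just names for the (shifted) field values on the vertices of an elementary square. *)

theory Defs
  imports Complex_Main
begin

type_synonym C2 = "complex \<times> complex"

text \<open>
  Rational maps between the spaces C2, C2 x C2 and C2 x C2 x C2 are modelled as partial functions
  (type constructor \<open>\<rightharpoonup>\<close>), undefined where a denominator in the defining formulas vanishes.
  Their composition is the library's \<open>\<circ>\<^sub>m\<close>, so that a composite is defined only where all
  intermediate expressions are. A set \<open>C\<close> of complex-valued functions on a type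
  plays the role of its coordinate system.
\<close>

definition coords_C2 :: "(C2 \<Rightarrow> complex) set" where
  "coords_C2 = {fst, snd}"

definition coords_prod ::
    "('a \<Rightarrow> complex) set \<Rightarrow> ('b \<Rightarrow> complex) set \<Rightarrow> ('a \<times> 'b \<Rightarrow> complex) set" where
  "coords_prod A B = (\<lambda>c. c \<circ> fst) ` A \<union> (\<lambda>c. c \<circ> snd) ` B"

abbreviation coords_pair :: "(C2 \<times> C2 \<Rightarrow> complex) set" where
  "coords_pair \<equiv> coords_prod coords_C2 coords_C2"

abbreviation coords_triple :: "(C2 \<times> C2 \<times> C2 \<Rightarrow> complex) set" where
  "coords_triple \<equiv> coords_prod coords_C2 coords_pair"

inductive polynomial_in :: "('a \<Rightarrow> complex) set \<Rightarrow> ('a \<Rightarrow> complex) \<Rightarrow> bool"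
  for C :: "('a \<Rightarrow> complex) set" where
  const: "polynomial_in C (\<lambda>_. a)"
| coord: "c \<in> C \<Longrightarrow> polynomial_in C c"
| add: "polynomial_in C f \<Longrightarrow> polynomial_in C g \<Longrightarrow> polynomial_in C (\<lambda>x. f x + g x)"
| mult: "polynomial_in C f \<Longrightarrow> polynomial_in C g \<Longrightarrow> polynomial_in C (\<lambda>x. f x * g x)"

text \<open>The set contains a nonempty Zariski-open set.\<close>

definition generic :: "('a \<Rightarrow> complex) set \<Rightarrow> 'a set \<Rightarrow> bool" where
  "generic C S \<longleftrightarrow>
     (\<exists>f. polynomial_in C f \<and> (\<exists>x. f x \<noteq> 0) \<and> {x. f x \<noteq> 0} \<subseteq> S)"

definition rational_map ::
    "('a \<Rightarrow> complex) set \<Rightarrow> ('b \<Rightarrow> complex) set \<Rightarrow> ('a \<rightharpoonup> 'b) \<Rightarrow> bool" where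
  "rational_map A B F \<longleftrightarrow> generic A (dom F) \<and>
     (\<forall>c\<in>B. \<exists>n d. polynomial_in A n \<and> polynomial_in A d \<and>
        (\<forall>x y. F x = Some y \<longrightarrow> d x \<noteq> 0 \<and> c y = n x / d x))"

text \<open>Genericity of the two domains prevents the equality from being vacuous.\<close>

definition rational_eq ::
    "('a \<Rightarrow> complex) set \<Rightarrow> ('a \<rightharpoonup> 'b) \<Rightarrow> ('a \<rightharpoonup> 'b) \<Rightarrow> bool" where
  "rational_eq C F G \<longleftrightarrow>
     generic C (dom F) \<and> generic C (dom G) \<and> (\<forall>x \<in> dom F \<inter> dom G. F x = G x)"

definition birational_map ::
    "('a \<Rightarrow> complex) set \<Rightarrow> ('b \<Rightarrow> complex) set \<Rightarrow> ('a \<rightharpoonup> 'b) \<Rightarrow> bool" where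
  "birational_map A B F \<longleftrightarrow> rational_map A B F \<and>
     (\<exists>G. rational_map B A G \<and> rational_eq A (G \<circ>\<^sub>m F) Some \<and> rational_eq B (F \<circ>\<^sub>m G) Some)"

text \<open>
  Both \<open>x\<^sup>1 \<noteq> y\<^sup>2\<close> and \<open>P \<noteq> 0\<close> are needed for the formulas to make sense.
\<close>

definition R :: "complex \<Rightarrow> complex \<Rightarrow> C2 \<times> C2 \<rightharpoonup> C2 \<times> C2" where
  "R \<beta>1 \<beta>2 = (\<lambda>((x1, x2), (y1, y2)).
     let P = 1 + (\<beta>1 - \<beta>2) / (x1 - y2)
     in if x1 - y2 = 0 \<or> P = 0 then None
        else Some ((y1 * inverse P, y2 * P), (x1 * P, x2 + y2 * (1 - P))))"

definition act12 :: "(C2 \<times> C2 \<rightharpoonup> C2 \<times> C2) \<Rightarrow> (C2 \<times> C2 \<times> C2 \<rightharpoonup> C2 \<times> C2 \<times> C2)" where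
  "act12 F = (\<lambda>(x, y, z). map_option (\<lambda>(p, q). (p, q, z)) (F (x, y)))"

definition act13 :: "(C2 \<times> C2 \<rightharpoonup> C2 \<times> C2) \<Rightarrow> (C2 \<times> C2 \<times> C2 \<rightharpoonup> C2 \<times> C2 \<times> C2)" where
  "act13 F = (\<lambda>(x, y, z). map_option (\<lambda>(p, q). (p, y, q)) (F (x, z)))"

definition act23 :: "(C2 \<times> C2 \<rightharpoonup> C2 \<times> C2) \<Rightarrow> (C2 \<times> C2 \<times> C2 \<rightharpoonup> C2 \<times> C2 \<times> C2)" where
  "act23 F = (\<lambda>(x, y, z). map_option (\<lambda>(p, q). (x, p, q)) (F (y, z)))"

end

theory Submission
  imports Defs
begin

text \<open>
  The map is governed by the scalar \<open>P\<close>, which depends on the arguments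
  through the difference \<open>x\<^sup>1 - y\<^sup>2\<close> alone. Applying the map multiplies this difference by \<open>P\<close>:
  \<open>q\<^sup>1 - p\<^sup>2 = (x\<^sup>1 - y\<^sup>2) P\<close>. The scalar that \<open>R(\<beta>\<^sub>2,\<beta>\<^sub>1)\<close> computes from \<open>(q,p)\<close> is therefore
  \<open>1 - (\<beta>\<^sub>1 - \<beta>\<^sub>2) / (q\<^sup>1 - p\<^sup>2) = 1/P\<close>, and so \<open>R(\<beta>\<^sub>2,\<beta>\<^sub>1)\<close> conjugated by the exchange of the two
  arguments inverts \<open>R(\<beta>\<^sub>1,\<beta>\<^sub>2)\<close> (\<open>R_unitary\<close>). This gives birationality, since \<open>R\<close> is visibly rational.

  For the lattice equations \<open>x\<^sup>1 - y\<^sup>2 = u (1 - u\<^sub>1 v\<^sub>2) / u\<^sub>1\<close>, and the first equation then says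
  \<open>P = u\<^sub>1\<^sub>2 / u\<close>. The four components are immediate, the last one by the second equation.

  Each side of the Yang-Baxter relation involves three scalars, one for each pair of indices. All six
  depend only on \<open>A = x\<^sup>1 - y\<^sup>2\<close>, \<open>a = y\<^sup>1\<close> and \<open>c = z\<^sup>2\<close>. Let \<open>P\<close>, \<open>\<lambda>\<close> be the scalars of the pairs
  12 and 13 on the left-hand side, and \<open>S\<close>, \<open>\<rho>\<close> those of the pairs 23 and 13 on the right-hand side.
  The point of the proof is that the last scalars are then determined: the one of the pair 23 on the
  left is \<open>\<rho> / P\<close>, and the one of the pair 12 on the right is \<open>\<lambda> / S\<close>
  (\<open>yang_baxter_left\<close>, \<open>yang_baxter_right\<close>). Multiplicatively, the total factors picked up by the
  coordinates then agree, and the two additive components agree by the single identity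
  \<open>(1 - \<lambda>) \<rho> / P = (1 - S) \<rho> + S - \<lambda>\<close> (\<open>additive_identity\<close>).

  All six scalars are quotients of products of eight nonzero polynomials: \<open>A\<close>, \<open>A + b\<close>, \<open>a - c\<close>,
  \<open>a - c + d\<close> with \<open>b = \<beta>\<^sub>1 - \<beta>\<^sub>2\<close>, \<open>d = \<beta>\<^sub>2 - \<beta>\<^sub>3\<close>, and the numerators and denominators of \<open>\<lambda>\<close> and \<open>\<rho>\<close>.
  Each side of the relation is defined exactly where six of them do not vanish, hence generically
  (\<open>generic_yang_baxter_factors\<close>).
\<close>

section \<open>Polynomials and generic sets\<close>

lemma polynomial_in_diff:
  assumes "polynomial_in C f" "polynomial_in C g"
  shows "polynomial_in C (\<lambda>x. f x - g x)"
  using polynomial_in.add[OF assms(1) polynomial_in.mult[OF polynomial_in.const[of C "-1"] assms(2)]]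
  by simp

lemmas polynomial_intros = polynomial_in.const polynomial_in.add polynomial_in.mult polynomial_in_diff

lemma polynomial_pair:
  "polynomial_in coords_pair (\<lambda>v. fst (fst v))"
  "polynomial_in coords_pair (\<lambda>v. snd (fst v))"
  "polynomial_in coords_pair (\<lambda>v. fst (snd v))"
  "polynomial_in coords_pair (\<lambda>v. snd (snd v))"
  by (rule polynomial_in.coord, simp add: coords_prod_def coords_C2_def comp_def)+

lemma polynomial_triple:
  "polynomial_in coords_triple (\<lambda>v. fst (fst v))"
  "polynomial_in coords_triple (\<lambda>v. snd (fst v))"
  "polynomial_in coords_triple (\<lambda>v. fst (fst (snd v)))"
  "polynomial_in coords_triple (\<lambda>v. snd (fst (snd v)))"
  "polynomial_in coords_triple (\<lambda>v. fst (snd (snd v)))"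
  "polynomial_in coords_triple (\<lambda>v. snd (snd (snd v)))"
  by (rule polynomial_in.coord, simp add: coords_prod_def coords_C2_def comp_def)+

lemma coords_pair_swap: "c \<in> coords_pair \<Longrightarrow> c \<circ> prod.swap \<in> coords_pair"
  by (auto simp: coords_prod_def coords_C2_def comp_def)

lemma polynomial_in_swap:
  "polynomial_in coords_pair f \<Longrightarrow> polynomial_in coords_pair (\<lambda>v. f (prod.swap v))"
proof (induction rule: polynomial_in.induct)
  case (coord c)
  then show ?case
    using polynomial_in.coord[OF coords_pair_swap] by (simp add: comp_def)
qed (auto intro: polynomial_in.intros)

lemma generic_UNIV: "generic C UNIV"
  unfolding generic_def by (intro exI[of _ "\<lambda>_. 1"]) (auto intro: polynomial_in.const)

lemma generic_mono: "generic C S \<Longrightarrow> S \<subseteq> T \<Longrightarrow> generic C T"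
  unfolding generic_def by blast

lemma generic_vimage_swap:
  assumes "generic coords_pair S"
  shows "generic coords_pair (prod.swap -` S)"
proof -
  obtain f x where f: "polynomial_in coords_pair f" "f x \<noteq> 0" "{x. f x \<noteq> 0} \<subseteq> S"
    using assms by (auto simp: generic_def)
  have "f (prod.swap (prod.swap x)) \<noteq> 0"
    using f(2) by simp
  then show ?thesis
    using polynomial_in_swap[OF f(1)] f(3) unfolding generic_def by blast
qed

section \<open>The map and its inverse\<close>

lemma R_eq_Some:
  assumes "x1 - y2 = w" "w \<noteq> 0" "1 + (\<beta>1 - \<beta>2) / w = P" "P \<noteq> 0"
  shows "R \<beta>1 \<beta>2 ((x1, x2), (y1, y2)) = Some ((y1 / P, y2 * P), (x1 * P, x2 + y2 * (1 - P)))"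
  using assms by (auto simp: R_def Let_def field_class.field_divide_inverse)

lemma R_eq_None:
  assumes "x1 - y2 = w" "w \<noteq> 0 \<Longrightarrow> 1 + (\<beta>1 - \<beta>2) / w = P" "w = 0 \<or> P = 0"
  shows "R \<beta>1 \<beta>2 ((x1, x2), (y1, y2)) = None"
proof (cases "w = 0")
  case True
  then show ?thesis using assms(1) by (simp add: R_def Let_def)
next
  case False
  then have "1 + (\<beta>1 - \<beta>2) / w = 0" using assms(2,3) by simp
  then show ?thesis using assms(1) by (simp add: R_def Let_def)
qed

lemma R_SomeE:
  assumes "R \<beta>1 \<beta>2 ((x1, x2), (y1, y2)) = Some v"
  obtains P where "x1 - y2 \<noteq> 0" "P = 1 + (\<beta>1 - \<beta>2) / (x1 - y2)" "P \<noteq> 0"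
    "v = ((y1 / P, y2 * P), (x1 * P, x2 + y2 * (1 - P)))"
  using assms
  by (auto simp: R_def Let_def field_class.field_divide_inverse split: if_splits)

lemma generic_dom_R: "generic coords_pair (dom (R \<beta>1 \<beta>2))"
proof -
  let ?w = "\<lambda>v :: C2 \<times> C2. fst (fst v) - snd (snd v)"
  let ?f = "\<lambda>v. ?w v * (?w v + (\<beta>1 - \<beta>2))"
  have "polynomial_in coords_pair ?f"
    by (intro polynomial_intros polynomial_pair)
  moreover have "\<exists>v. ?f v \<noteq> 0"
  proof -
    obtain t :: complex where "t \<notin> {0, - (\<beta>1 - \<beta>2)}"
      using ex_new_if_finite[OF infinite_UNIV_char_0, of "{0, - (\<beta>1 - \<beta>2)}"] by blast
    then have "?f ((t, 0), (0, 0)) \<noteq> 0"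
      unfolding insert_iff eq_neg_iff_add_eq_0 by simp
    then show ?thesis by (rule exI)
  qed
  moreover have "{v. ?f v \<noteq> 0} \<subseteq> dom (R \<beta>1 \<beta>2)"
  proof
    fix v assume "v \<in> {v. ?f v \<noteq> 0}"
    moreover obtain x1 x2 y1 y2 where v: "v = ((x1, x2), (y1, y2))"
      by (metis surj_pair)
    ultimately have nz: "x1 - y2 \<noteq> 0" "x1 - y2 + (\<beta>1 - \<beta>2) \<noteq> 0"
      by auto
    have "1 + k / w \<noteq> 0" if "w \<noteq> 0" "w + k \<noteq> 0" for w k :: complex
      using that by (simp add: divide_simps)
    from this[OF nz] have "1 + (\<beta>1 - \<beta>2) / (x1 - y2) \<noteq> 0" .
    from R_eq_Some[OF refl nz(1) refl this] show "v \<in> dom (R \<beta>1 \<beta>2)"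
      unfolding v by blast
  qed
  ultimately show ?thesis
    unfolding generic_def by blast
qed

lemma rational_map_R: "rational_map coords_pair coords_pair (R \<beta>1 \<beta>2)"
proof -
  let ?w = "\<lambda>v :: C2 \<times> C2. fst (fst v) - snd (snd v)"
  let ?b = "\<beta>1 - \<beta>2"
  have "\<exists>n d. polynomial_in coords_pair n \<and> polynomial_in coords_pair d \<and>
        (\<forall>v r. R \<beta>1 \<beta>2 v = Some r \<longrightarrow> d v \<noteq> 0 \<and> c r = n v / d v)"
    if c: "c \<in> coords_pair" for c
  proof -
    have value_R: "?w v \<noteq> 0 \<and> ?w v + ?b \<noteq> 0 \<and>
        r = ((fst (snd v) * ?w v / (?w v + ?b), snd (snd v) * (?w v + ?b) / ?w v),
             (fst (fst v) * (?w v + ?b) / ?w v, (snd (fst v) * ?w v - snd (snd v) * ?b) / ?w v))"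
      if Some_r: "R \<beta>1 \<beta>2 v = Some r" for v r
    proof -
      obtain x1 x2 y1 y2 where v: "v = ((x1, x2), (y1, y2))"
        by (metis surj_pair)
      obtain P where P: "x1 - y2 \<noteq> 0" "P = 1 + ?b / (x1 - y2)" "P \<noteq> 0"
        and r: "r = ((y1 / P, y2 * P), (x1 * P, x2 + y2 * (1 - P)))"
        using R_SomeE[OF Some_r[unfolded v]] .
      define w where "w = x1 - y2"
      have w: "w \<noteq> 0" and P': "P = (w + ?b) / w"
        using P by (auto simp: w_def field_simps)
      have wb: "w + ?b \<noteq> 0"
        using P(3) P' by auto
      have "x2 + y2 * (1 - P) = (x2 * w - y2 * ?b) / w"
        unfolding P' using w by (simp add: divide_simps) (simp add: algebra_simps)
      then show ?thesis
        using w wb unfolding r v by (simp add: P' w_def[symmetric])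
    qed
    consider "c = fst \<circ> fst" | "c = snd \<circ> fst" | "c = fst \<circ> snd" | "c = snd \<circ> snd"
      using c by (auto simp: coords_prod_def coords_C2_def)
    then show ?thesis
    proof cases
      case 1
      show ?thesis
        by (rule exI[of _ "\<lambda>v. fst (snd v) * ?w v"], rule exI[of _ "\<lambda>v. ?w v + ?b"],
            intro conjI polynomial_intros polynomial_pair) (auto simp: 1 dest: value_R)
    next
      case 2
      show ?thesis
        by (rule exI[of _ "\<lambda>v. snd (snd v) * (?w v + ?b)"], rule exI[of _ ?w],
            intro conjI polynomial_intros polynomial_pair) (auto simp: 2 dest: value_R)
    next
      case 3
      show ?thesis
        by (rule exI[of _ "\<lambda>v. fst (fst v) * (?w v + ?b)"], rule exI[of _ ?w],
            intro conjI polynomial_intros polynomial_pair) (auto simp: 3 dest: value_R)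
    next
      case 4
      show ?thesis
        by (rule exI[of _ "\<lambda>v. snd (fst v) * ?w v - snd (snd v) * ?b"], rule exI[of _ ?w],
            intro conjI polynomial_intros polynomial_pair) (auto simp: 4 dest: value_R)
    qed
  qed
  then show ?thesis
    unfolding rational_map_def using generic_dom_R by blast
qed

text \<open>
  The difference that governs the second application is \<open>(x\<^sup>1 - y\<^sup>2) P\<close>, which turns \<open>P\<close> into \<open>1/P\<close>.
  The second application is defined because \<open>P \<noteq> 0\<close>.
\<close>

lemma R_unitary:
  assumes "R \<beta>1 \<beta>2 (x, y) = Some (p, q)"
  shows "R \<beta>2 \<beta>1 (q, p) = Some (y, x)"
proof -
  obtain x1 x2 y1 y2 where xy: "x = (x1, x2)" "y = (y1, y2)"
    by (metis surj_pair)
  obtain P where P: "x1 - y2 \<noteq> 0" "P = 1 + (\<beta>1 - \<beta>2) / (x1 - y2)" "P \<noteq> 0"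
    and pq: "p = (y1 / P, y2 * P)" "q = (x1 * P, x2 + y2 * (1 - P))"
    by (rule R_SomeE[OF assms[unfolded xy]]) simp
  have diff: "x1 * P - y2 * P = (x1 - y2) * P" "(x1 - y2) * P \<noteq> 0"
    using P(1,3) by (simp_all add: left_diff_distrib)
  have "w * (1 + k / w) = w + k" if "w \<noteq> 0" for w k :: complex
    using that by (simp add: field_simps)
  from this[OF P(1), of "\<beta>1 - \<beta>2"] have "(x1 - y2) * P = x1 - y2 + (\<beta>1 - \<beta>2)"
    by (simp only: P(2)[symmetric])
  then have "\<beta>2 - \<beta>1 = (x1 - y2) * (1 - P)"
    unfolding right_diff_distrib by simp
  then have "(\<beta>2 - \<beta>1) / ((x1 - y2) * P) = (x1 - y2) * (1 - P) / ((x1 - y2) * P)"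
    by (rule arg_cong)
  also have "\<dots> = (1 - P) / P"
    by (rule mult_divide_mult_cancel_left[OF P(1)])
  also have "\<dots> = 1 / P - 1"
    using P(3) by (simp add: diff_divide_distrib)
  finally have "1 + (\<beta>2 - \<beta>1) / ((x1 - y2) * P) = 1 / P"
    by (simp only: add_diff_cancel_left' add_diff_eq)
  moreover have "1 / P \<noteq> 0"
    using P(3) by simp
  ultimately have "R \<beta>2 \<beta>1 (q, p) = Some ((y1 / P / (1 / P), y2 * P * (1 / P)),
      (x1 * P * (1 / P), x2 + y2 * (1 - P) + y2 * P * (1 - 1 / P)))"
    unfolding pq by (rule R_eq_Some[OF diff])
  moreover have "y1 / P / (1 / P) = y1" "y2 * P * (1 / P) = y2" "x1 * P * (1 / P) = x1"
    using P(3) by simp_all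
  moreover have "x2 + y2 * (1 - P) + y2 * P * (1 - 1 / P) = x2"
    using P(3) by (simp add: right_diff_distrib)
  ultimately show ?thesis
    by (simp only: xy)
qed

definition R_inverse :: "complex \<Rightarrow> complex \<Rightarrow> C2 \<times> C2 \<rightharpoonup> C2 \<times> C2" where
  "R_inverse \<beta>1 \<beta>2 v = map_option prod.swap (R \<beta>2 \<beta>1 (prod.swap v))"

lemma rational_map_R_inverse: "rational_map coords_pair coords_pair (R_inverse \<beta>1 \<beta>2)"
  unfolding rational_map_def
proof (intro conjI ballI)
  have "dom (R_inverse \<beta>1 \<beta>2) = prod.swap -` dom (R \<beta>2 \<beta>1)"
    by (auto simp: R_inverse_def dom_def)
  then show "generic coords_pair (dom (R_inverse \<beta>1 \<beta>2))"
    using generic_vimage_swap[OF generic_dom_R] by simp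
next
  fix c assume "c \<in> coords_pair"
  from bspec[OF rational_map_R[unfolded rational_map_def, THEN conjunct2] coords_pair_swap[OF this]]
  obtain n d where
    nd: "polynomial_in coords_pair n" "polynomial_in coords_pair d"
      "\<And>v r. R \<beta>2 \<beta>1 v = Some r \<Longrightarrow> d v \<noteq> 0 \<and> c (prod.swap r) = n v / d v"
    unfolding comp_def by blast
  show "\<exists>n d. polynomial_in coords_pair n \<and> polynomial_in coords_pair d \<and>
      (\<forall>v r. R_inverse \<beta>1 \<beta>2 v = Some r \<longrightarrow> d v \<noteq> 0 \<and> c r = n v / d v)"
    by (rule exI[of _ "\<lambda>v. n (prod.swap v)"], rule exI[of _ "\<lambda>v. d (prod.swap v)"])
       (use nd in \<open>auto simp: R_inverse_def intro: polynomial_in_swap\<close>)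
qed

lemma R_inverse_R:
  assumes "R \<beta>1 \<beta>2 v = Some r"
  shows "R_inverse \<beta>1 \<beta>2 r = Some v"
proof -
  obtain x y p q where vr: "v = (x, y)" "r = (p, q)"
    by (cases v, cases r)
  from R_unitary[OF assms[unfolded vr]] show ?thesis
    by (simp add: R_inverse_def vr)
qed

lemma R_R_inverse:
  assumes "R_inverse \<beta>1 \<beta>2 v = Some r"
  shows "R \<beta>1 \<beta>2 r = Some v"
proof -
  obtain x y p q where vr: "v = (x, y)" "r = (p, q)"
    by (cases v, cases r)
  have "R \<beta>2 \<beta>1 (y, x) = Some (q, p)"
    using assms by (auto simp: R_inverse_def vr)
  from R_unitary[OF this] show ?thesis
    by (simp add: vr)
qed

lemma rational_eq_inverse:
  assumes "generic C (dom F)" "\<And>v r. F v = Some r \<Longrightarrow> G r = Some v"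
  shows "rational_eq C (G \<circ>\<^sub>m F) Some"
proof -
  have "dom (G \<circ>\<^sub>m F) = dom F"
    using assms(2) by (fastforce simp: dom_def map_comp_def split: option.splits)
  moreover have "dom (Some :: 'a \<Rightarrow> 'a option) = UNIV"
    by auto
  ultimately show ?thesis
    using assms unfolding rational_eq_def
    by (auto simp: generic_UNIV map_comp_def split: option.splits)
qed

lemma birational_map_R: "birational_map coords_pair coords_pair (R \<beta>1 \<beta>2)"
  unfolding birational_map_def
proof (intro conjI exI[of _ "R_inverse \<beta>1 \<beta>2"])
  show "rational_eq coords_pair (R_inverse \<beta>1 \<beta>2 \<circ>\<^sub>m R \<beta>1 \<beta>2) Some"
    by (rule rational_eq_inverse[OF generic_dom_R R_inverse_R])
  show "rational_eq coords_pair (R \<beta>1 \<beta>2 \<circ>\<^sub>m R_inverse \<beta>1 \<beta>2) Some"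
    using rational_map_R_inverse R_R_inverse
    by (intro rational_eq_inverse) (auto simp: rational_map_def)
qed (rule rational_map_R rational_map_R_inverse)+

section \<open>The lattice equations\<close>

lemma R_lattice:
  fixes u v u1 u2 v2 u12 v12 :: complex
  assumes nz: "u \<noteq> 0" "u1 \<noteq> 0" "u12 \<noteq> 0" "1 - u1 * v2 \<noteq> 0"
    and u12: "u12 = u + (\<beta>1 - \<beta>2) / (1 - u1 * v2) * u1"
    and v12: "v12 = v - (\<beta>1 - \<beta>2) / (1 - u1 * v2) * v2"
  shows "R \<beta>1 \<beta>2 ((u / u1, v * u1), (u2 / u, u * v2)) =
    Some ((u2 / u12, v2 * u12), (u12 / u1, u1 * v12))"
proof -
  define k where "k = (\<beta>1 - \<beta>2) / (1 - u1 * v2)"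
  have diff: "u / u1 - u * v2 = u * (1 - u1 * v2) / u1" "u * (1 - u1 * v2) / u1 \<noteq> 0"
    using nz by (simp_all add: field_simps)
  have "(\<beta>1 - \<beta>2) / (u * (1 - u1 * v2) / u1) = k * u1 / u"
    by (simp add: k_def)
  then have "1 + (\<beta>1 - \<beta>2) / (u * (1 - u1 * v2) / u1) = u12 / u"
    using nz(1) by (simp add: u12 k_def[symmetric] add_divide_distrib)
  moreover have "v * u1 + u * v2 * (1 - u12 / u) = u1 * v12"
  proof -
    have "u * (1 - u12 / u) = - k * u1"
      using nz(1) by (simp add: u12 k_def[symmetric] field_simps)
    then have "u * v2 * (1 - u12 / u) = - k * u1 * v2"
      by (metis mult.assoc mult.commute)
    then show ?thesis
      by (simp add: v12 k_def[symmetric] algebra_simps)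
  qed
  ultimately show ?thesis
    using R_eq_Some[OF diff, of \<beta>1 \<beta>2 "u12 / u"] nz by simp
qed

section \<open>The Yang-Baxter relation\<close>

text \<open>
  With \<open>b = \<beta>\<^sub>1 - \<beta>\<^sub>2\<close>, \<open>d = \<beta>\<^sub>2 - \<beta>\<^sub>3\<close>, \<open>A = x\<^sup>1 - y\<^sup>2\<close>, \<open>a = y\<^sup>1\<close>, \<open>c = z\<^sup>2\<close>, the scalar of the pair 13
  is \<open>left_num / left_den\<close> on the left-hand side and \<open>right_num / right_den\<close> on the right-hand side.
\<close>

definition left_den :: "complex \<Rightarrow> complex \<Rightarrow> complex \<Rightarrow> complex \<Rightarrow> complex" where
  "left_den b A a c = A * (a - c) - b * c"

definition left_num :: "complex \<Rightarrow> complex \<Rightarrow> complex \<Rightarrow> complex \<Rightarrow> complex \<Rightarrow> complex" where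
  "left_num b d A a c = left_den b A a c + (b + d) * (A + b)"

definition right_den :: "complex \<Rightarrow> complex \<Rightarrow> complex \<Rightarrow> complex \<Rightarrow> complex" where
  "right_den d A a c = A * (a - c) + d * c"

definition right_num :: "complex \<Rightarrow> complex \<Rightarrow> complex \<Rightarrow> complex \<Rightarrow> complex \<Rightarrow> complex" where
  "right_num b d A a c = right_den d A a c + (b + d) * (a - c)"

text \<open>
  The next two identities are what makes the third scalar on either side a quotient of two others:
  their left-hand sides are the numerators that the third scalars have a priori.
\<close>

lemma left_third_numerator:
  "(A + b) * right_den d A a c + d * left_den b A a c = A * right_num b d A a c"
  by (simp add: left_den_def right_num_def right_den_def algebra_simps)

lemma right_third_numerator:
  "(a - c + d) * left_den b A a c + b * right_num b d A a c = (a - c) * left_num b d A a c"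
  by (simp add: left_den_def left_num_def right_num_def right_den_def algebra_simps)

text \<open>
  The coefficients of \<open>z\<^sup>2\<close> in the second component of the middle entry: once the multiplicative
  factors of the two sides agree, this is all that remains to be compared.
\<close>

lemma additive_identity:
  assumes nz: "A \<noteq> 0" "A + b \<noteq> 0" "a - c \<noteq> 0" "left_den b A a c \<noteq> 0" "right_den d A a c \<noteq> 0"
    and P: "P = (A + b) / A" and S: "S = (a - c + d) / (a - c)"
    and l: "l = left_num b d A a c / left_den b A a c"
    and r: "r = right_num b d A a c / right_den d A a c"
  shows "(1 - l) * (r / P) = (1 - S) * r + S - l"
proof -
  let ?D = "left_den b A a c" and ?E = "right_den d A a c"
  define k where "k = b + d"
  have l': "1 - l = - (k * (A + b) / ?D)"
    unfolding l left_num_def k_def[symmetric] using nz(4) by (simp add: add_divide_distrib)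
  have r': "r - 1 = k * (a - c) / ?E"
    unfolding r right_num_def k_def[symmetric] using nz(5) by (simp add: add_divide_distrib)
  have S': "1 - S = - d / (a - c)"
    unfolding S using nz by (simp add: field_simps)
  \<comment> \<open>The difference regroups into two products, both of which cancel to \<open>- k * d / right_den\<close>.\<close>
  have "(1 - l) * (r / P) - ((1 - S) * r + S - l) = (1 - l) * (r / P - 1) - (1 - S) * (r - 1)"
    by (simp add: algebra_simps)
  also have "r / P - 1 = d * ?D / ((A + b) * ?E)"
  proof -
    have "r / P = (A * right_num b d A a c) / ((A + b) * ?E)"
      unfolding r P by (simp add: mult.commute)
    then show ?thesis
      unfolding left_third_numerator[symmetric] using nz by (simp add: add_divide_distrib)
  qed
  also have "(1 - l) * (d * ?D / ((A + b) * ?E)) = - (k * d / ?E)"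
    unfolding l' using nz(2,4) by simp
  also have "(1 - S) * (r - 1) = - (k * d / ?E)"
    unfolding S' r' using nz(3) by (simp add: mult.commute)
  finally show ?thesis by simp
qed

lemma act12_eq: "act12 F ((x, y, z)) = map_option (\<lambda>(p, q). (p, q, z)) (F (x, y))"
  and act13_eq: "act13 F ((x, y, z)) = map_option (\<lambda>(p, q). (p, y, q)) (F (x, z))"
  and act23_eq: "act23 F ((x, y, z)) = map_option (\<lambda>(p, q). (x, p, q)) (F (y, z))"
  by (simp_all add: act12_def act13_def act23_def)

lemmas act_eq = act12_eq act13_eq act23_eq

text \<open>
  The relation is asserted wherever both sides are defined, so their exact domains are needed. The
  domain conditions say that the differences and scalars met along the way are nonzero: the
  differences at the three steps are \<open>A\<close>, \<open>left_den / (A + b)\<close> and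
  \<open>(A + b) * right_den / left_den\<close>, and the scalars are \<open>P\<close>, \<open>l\<close> and \<open>r / P\<close>.
\<close>

lemma yang_baxter_left:
  fixes \<beta>1 \<beta>2 \<beta>3 x1 x2 y1 y2 z1 z2 :: complex
  defines "b \<equiv> \<beta>1 - \<beta>2" and "d \<equiv> \<beta>2 - \<beta>3" and "A \<equiv> x1 - y2"
  defines "P \<equiv> (A + b) / A"
    and "l \<equiv> left_num b d A y1 z2 / left_den b A y1 z2"
    and "r \<equiv> right_num b d A y1 z2 / right_den d A y1 z2"
  shows "(act23 (R \<beta>2 \<beta>3) \<circ>\<^sub>m act13 (R \<beta>1 \<beta>3) \<circ>\<^sub>m act12 (R \<beta>1 \<beta>2)) ((x1, x2), (y1, y2), (z1, z2)) =
    (if A = 0 \<or> A + b = 0 \<or> left_den b A y1 z2 = 0 \<or> left_num b d A y1 z2 = 0 \<or>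
        right_den d A y1 z2 = 0 \<or> right_num b d A y1 z2 = 0
     then None
     else Some ((z1 / l, z2 * l),
                (y1 * l / r, (y2 * P + z2 * (1 - l)) * (r / P)),
                (x1 * r, x2 + y2 * (1 - P) + (y2 * P + z2 * (1 - l)) * (1 - r / P))))"
proof -
  let ?D = "left_den b A y1 z2" and ?N = "left_num b d A y1 z2"
  let ?E = "right_den d A y1 z2" and ?M = "right_num b d A y1 z2"
  have bd: "\<beta>1 - \<beta>3 = b + d"
    by (simp add: b_def d_def)
  have P_A: "1 + (\<beta>1 - \<beta>2) / A = P" if "A \<noteq> 0"
    using that by (simp add: P_def b_def field_simps)
  show ?thesis
  proof (cases "A = 0 \<or> A + b = 0")
    case True
    then have "R \<beta>1 \<beta>2 ((x1, x2), (y1, y2)) = None"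
      by (intro R_eq_None[OF A_def[symmetric, THEN meta_eq_to_obj_eq] P_A]) (auto simp: P_def)
    then show ?thesis
      using True by (auto simp: map_comp_def act_eq)
  next
    case False
    then have nz: "A \<noteq> 0" "A + b \<noteq> 0" and P: "P \<noteq> 0"
      by (auto simp: P_def)
    have step1: "R \<beta>1 \<beta>2 ((x1, x2), (y1, y2)) =
        Some ((y1 / P, y2 * P), (x1 * P, x2 + y2 * (1 - P)))"
      using R_eq_Some[OF _ nz(1) P_A[OF nz(1)] P] by (simp add: A_def)
    have diff2: "y1 / P - z2 = ?D / (A + b)"
      using nz by (simp add: P_def left_den_def field_simps)
    have l: "1 + (\<beta>1 - \<beta>3) / (?D / (A + b)) = l" if "?D / (A + b) \<noteq> 0"
      using that by (simp add: bd l_def left_num_def add_divide_distrib)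
    show ?thesis
    proof (cases "?D = 0 \<or> ?N = 0")
      case True
      then have "R \<beta>1 \<beta>3 ((y1 / P, y2 * P), (z1, z2)) = None"
        by (intro R_eq_None[OF diff2 l]) (auto simp: l_def)
      then show ?thesis
        using True by (auto simp: map_comp_def act_eq step1)
    next
      case False
      then have nz2: "?D \<noteq> 0" "?N \<noteq> 0" and l0: "l \<noteq> 0"
        by (auto simp: l_def)
      have step2: "R \<beta>1 \<beta>3 ((y1 / P, y2 * P), (z1, z2)) =
          Some ((z1 / l, z2 * l), (y1 / P * l, y2 * P + z2 * (1 - l)))"
        using R_eq_Some[OF diff2 _ l l0] nz(2) nz2(1) by simp
      have diff3: "x1 * P - (y2 * P + z2 * (1 - l)) = (A + b) * ?E / ?D"
      proof -
        have "x1 * P - y2 * P = A * P"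
          by (simp add: A_def left_diff_distrib)
        then have "x1 * P - y2 * P = A + b"
          using nz(1) by (simp add: P_def)
        moreover have "1 - l = - ((b + d) * (A + b) / ?D)"
          using nz2(1) by (simp add: l_def left_num_def add_divide_distrib)
        ultimately have "x1 * P - (y2 * P + z2 * (1 - l)) =
            (A + b) + z2 * ((b + d) * (A + b) / ?D)"
          by (simp add: diff_diff_eq[symmetric])
        also have "\<dots> = (A + b) * (?D + z2 * (b + d)) / ?D"
          using nz2(1) by (simp add: field_simps)
        also have "?D + z2 * (b + d) = ?E"
          by (simp add: left_den_def right_den_def algebra_simps)
        finally show ?thesis .
      qed
      have r: "1 + (\<beta>2 - \<beta>3) / ((A + b) * ?E / ?D) = r / P" if "(A + b) * ?E / ?D \<noteq> 0"
      proof -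
        have "1 + (\<beta>2 - \<beta>3) / ((A + b) * ?E / ?D) = ((A + b) * ?E + d * ?D) / ((A + b) * ?E)"
          using that by (auto simp: d_def add_divide_distrib)
        then show ?thesis
          unfolding left_third_numerator by (simp add: r_def P_def mult.commute)
      qed
      show ?thesis
      proof (cases "?E = 0 \<or> ?M = 0")
        case True
        then have "R \<beta>2 \<beta>3 ((x1 * P, x2 + y2 * (1 - P)), (y1 / P * l, y2 * P + z2 * (1 - l))) = None"
          by (intro R_eq_None[OF diff3 r]) (auto simp: r_def)
        then show ?thesis
          using True by (auto simp: map_comp_def act_eq step1 step2)
      next
        case False
        then have nz3: "?E \<noteq> 0" "?M \<noteq> 0" and r0: "r / P \<noteq> 0"
          using P by (auto simp: r_def)
        have "R \<beta>2 \<beta>3 ((x1 * P, x2 + y2 * (1 - P)), (y1 / P * l, y2 * P + z2 * (1 - l))) =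
            Some ((y1 / P * l / (r / P), (y2 * P + z2 * (1 - l)) * (r / P)),
              (x1 * P * (r / P),
               x2 + y2 * (1 - P) + (y2 * P + z2 * (1 - l)) * (1 - r / P)))"
          by (rule R_eq_Some[OF diff3 _ r r0]) (use nz nz2 nz3 in simp_all)
        moreover have "y1 / P * l / (r / P) = y1 * l / r" "x1 * P * (r / P) = x1 * r"
          using P by simp_all
        ultimately show ?thesis
          using nz nz2 nz3 by (simp add: map_comp_def act_eq step1 step2)
      qed
    qed
  qed
qed

text \<open>
  Here the differences at the three steps are \<open>y1 - z2\<close>, \<open>right_den / (y1 - z2)\<close> and
  \<open>(y1 - z2 + d) * left_den / right_num\<close>, and the scalars are \<open>S\<close>, \<open>r\<close> and \<open>l / S\<close>.
\<close>

lemma yang_baxter_right: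
  fixes \<beta>1 \<beta>2 \<beta>3 x1 x2 y1 y2 z1 z2 :: complex
  defines "b \<equiv> \<beta>1 - \<beta>2" and "d \<equiv> \<beta>2 - \<beta>3" and "A \<equiv> x1 - y2" and "e \<equiv> y1 - z2"
  defines "S \<equiv> (e + d) / e"
    and "l \<equiv> left_num b d A y1 z2 / left_den b A y1 z2"
    and "r \<equiv> right_num b d A y1 z2 / right_den d A y1 z2"
  shows "(act12 (R \<beta>1 \<beta>2) \<circ>\<^sub>m act13 (R \<beta>1 \<beta>3) \<circ>\<^sub>m act23 (R \<beta>2 \<beta>3)) ((x1, x2), (y1, y2), (z1, z2)) =
    (if e = 0 \<or> e + d = 0 \<or> right_den d A y1 z2 = 0 \<or> right_num b d A y1 z2 = 0 \<or>
        left_den b A y1 z2 = 0 \<or> left_num b d A y1 z2 = 0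
     then None
     else Some ((z1 / l, z2 * l),
                (y1 * l / r, (y2 + z2 * (1 - S)) * r + z2 * S * (1 - l / S)),
                (x1 * r, x2 + (y2 + z2 * (1 - S)) * (1 - r))))"
proof -
  let ?D = "left_den b A y1 z2" and ?N = "left_num b d A y1 z2"
  let ?E = "right_den d A y1 z2" and ?M = "right_num b d A y1 z2"
  have bd: "\<beta>1 - \<beta>3 = b + d"
    by (simp add: b_def d_def)
  have S_e: "1 + (\<beta>2 - \<beta>3) / e = S" if "e \<noteq> 0"
    using that by (simp add: S_def d_def field_simps)
  show ?thesis
  proof (cases "e = 0 \<or> e + d = 0")
    case True
    then have "R \<beta>2 \<beta>3 ((y1, y2), (z1, z2)) = None"
      by (intro R_eq_None[OF e_def[symmetric, THEN meta_eq_to_obj_eq] S_e]) (auto simp: S_def)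
    then show ?thesis
      using True by (auto simp: map_comp_def act_eq)
  next
    case False
    then have nz: "e \<noteq> 0" "e + d \<noteq> 0" and S: "S \<noteq> 0"
      by (auto simp: S_def)
    have step1: "R \<beta>2 \<beta>3 ((y1, y2), (z1, z2)) =
        Some ((z1 / S, z2 * S), (y1 * S, y2 + z2 * (1 - S)))"
      using R_eq_Some[OF _ nz(1) S_e[OF nz(1)] S] by (simp add: e_def)
    have diff2: "x1 - (y2 + z2 * (1 - S)) = ?E / e"
    proof -
      have "1 - S = - (d / e)"
        using nz(1) by (simp add: S_def add_divide_distrib)
      then have "x1 - (y2 + z2 * (1 - S)) = A + z2 * (d / e)"
        by (simp add: A_def)
      also have "\<dots> = ?E / e"
        using nz(1) by (simp add: right_den_def e_def[symmetric] add_divide_distrib mult.commute)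
      finally show ?thesis .
    qed
    have r: "1 + (\<beta>1 - \<beta>3) / (?E / e) = r" if "?E / e \<noteq> 0"
      using that by (simp add: bd r_def right_num_def e_def[symmetric] add_divide_distrib)
    show ?thesis
    proof (cases "?E = 0 \<or> ?M = 0")
      case True
      then have "R \<beta>1 \<beta>3 ((x1, x2), (y1 * S, y2 + z2 * (1 - S))) = None"
        by (intro R_eq_None[OF diff2 r]) (auto simp: r_def)
      then show ?thesis
        using True by (auto simp: map_comp_def act_eq step1)
    next
      case False
      then have nz2: "?E \<noteq> 0" "?M \<noteq> 0" and r0: "r \<noteq> 0"
        by (auto simp: r_def)
      have step2: "R \<beta>1 \<beta>3 ((x1, x2), (y1 * S, y2 + z2 * (1 - S))) =
          Some ((y1 * S / r, (y2 + z2 * (1 - S)) * r), (x1 * r, x2 + (y2 + z2 * (1 - S)) * (1 - r)))"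
        using R_eq_Some[OF diff2 _ r r0] nz(1) nz2(1) by simp
      have diff3: "y1 * S / r - z2 * S = (e + d) * ?D / ?M"
      proof -
        have "y1 / r - z2 = (y1 * ?E - z2 * ?M) / ?M"
          using nz2 by (simp add: r_def field_simps)
        also have "y1 * ?E - z2 * ?M = e * ?D"
          by (simp add: left_den_def right_num_def right_den_def e_def algebra_simps)
        finally have "S * (y1 / r - z2) = (e + d) * ?D / ?M"
          using nz(1) by (simp add: S_def)
        then show ?thesis
          by (simp add: algebra_simps)
      qed
      have l: "1 + (\<beta>1 - \<beta>2) / ((e + d) * ?D / ?M) = l / S" if "(e + d) * ?D / ?M \<noteq> 0"
      proof -
        have "1 + (\<beta>1 - \<beta>2) / ((e + d) * ?D / ?M) = ((e + d) * ?D + b * ?M) / ((e + d) * ?D)"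
          using that by (auto simp: b_def add_divide_distrib)
        also have "(e + d) * ?D + b * ?M = e * ?N"
          unfolding e_def by (rule right_third_numerator)
        finally show ?thesis
          by (simp add: l_def S_def mult.commute)
      qed
      show ?thesis
      proof (cases "?D = 0 \<or> ?N = 0")
        case True
        then have "R \<beta>1 \<beta>2 ((y1 * S / r, (y2 + z2 * (1 - S)) * r), (z1 / S, z2 * S)) = None"
          by (intro R_eq_None[OF diff3 l]) (auto simp: l_def)
        then show ?thesis
          using True by (auto simp: map_comp_def act_eq step1 step2)
      next
        case False
        then have nz3: "?D \<noteq> 0" "?N \<noteq> 0" and l0: "l / S \<noteq> 0"
          using S by (auto simp: l_def)
        have "R \<beta>1 \<beta>2 ((y1 * S / r, (y2 + z2 * (1 - S)) * r), (z1 / S, z2 * S)) =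
            Some ((z1 / S / (l / S), z2 * S * (l / S)),
              (y1 * S / r * (l / S), (y2 + z2 * (1 - S)) * r + z2 * S * (1 - l / S)))"
          by (rule R_eq_Some[OF diff3 _ l l0]) (use nz nz2 nz3 in simp_all)
        moreover have "z1 / S / (l / S) = z1 / l" "z2 * S * (l / S) = z2 * l"
          "y1 * S / r * (l / S) = y1 * l / r"
          using S by simp_all
        ultimately show ?thesis
          using nz nz2 nz3 by (simp add: map_comp_def act_eq step1 step2)
      qed
    qed
  qed
qed

text \<open>
  A single polynomial, the product of all denominators and numerators, certifies that both sides are
  defined on a common generic set.
\<close>

lemma generic_yang_baxter_factors:
  fixes b d :: complex
  defines "f \<equiv> \<lambda>A a c. A * (A + b) * (a - c) * (a - c + d) * left_den b A a c * left_num b d A a c *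
    right_den d A a c * right_num b d A a c"
  shows "generic coords_triple
    {((x1, x2), (y1, y2), (z1, z2)) | x1 x2 y1 y2 z1 z2. f (x1 - y2) y1 z2 \<noteq> 0}"
proof -
  let ?f = "\<lambda>v :: C2 \<times> C2 \<times> C2. f (fst (fst v) - snd (fst (snd v))) (fst (fst (snd v))) (snd (snd (snd v)))"
  have "polynomial_in coords_triple ?f"
    unfolding f_def left_den_def left_num_def right_den_def right_num_def
    by (intro polynomial_intros polynomial_triple)
  moreover have "\<exists>v. ?f v \<noteq> 0"
  proof -
    \<comment> \<open>At \<open>c = 0\<close> all factors are simple enough to be avoided one variable after the other.\<close>
    obtain A :: complex where A: "A \<notin> {0, - b, - (b + d)}"
      using ex_new_if_finite[OF infinite_UNIV_char_0, of "{0, - b, - (b + d)}"] by blast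
    obtain a :: complex where a: "a \<notin> {0, - d, - ((b + d) * (A + b)) / A}"
      using ex_new_if_finite[OF infinite_UNIV_char_0, of "{0, - d, - ((b + d) * (A + b)) / A}"]
      by blast
    have "A * a + (b + d) * (A + b) \<noteq> 0"
    proof
      assume "A * a + (b + d) * (A + b) = 0"
      then have "A * a = - ((b + d) * (A + b))"
        by (simp only: eq_neg_iff_add_eq_0)
      then have "a = - ((b + d) * (A + b)) / A"
        using A by (metis insertI1 nonzero_mult_div_cancel_left)
      then show False
        using a by blast
    qed
    moreover have "A * a + (b + d) * a \<noteq> 0"
    proof -
      have "A + (b + d) \<noteq> 0"
        using A unfolding insert_iff eq_neg_iff_add_eq_0 by blast
      then show ?thesis
        using a by (simp flip: distrib_right)
    qed
    moreover have "A + b \<noteq> 0" "a + d \<noteq> 0"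
      using A a unfolding insert_iff eq_neg_iff_add_eq_0 by blast+
    ultimately have "f A a 0 \<noteq> 0"
      using A a by (simp add: f_def left_den_def left_num_def right_den_def right_num_def)
    then have "?f ((A, 0), (a, 0), (0, 0)) \<noteq> 0"
      by simp
    then show ?thesis by (rule exI)
  qed
  moreover have "{v. ?f v \<noteq> 0} \<subseteq>
      {((x1, x2), (y1, y2), (z1, z2)) | x1 x2 y1 y2 z1 z2. f (x1 - y2) y1 z2 \<noteq> 0}"
    by auto
  ultimately show ?thesis
    unfolding generic_def by blast
qed

lemma yang_baxter_R:
  "rational_eq coords_triple
     (act23 (R \<beta>2 \<beta>3) \<circ>\<^sub>m act13 (R \<beta>1 \<beta>3) \<circ>\<^sub>m act12 (R \<beta>1 \<beta>2))
     (act12 (R \<beta>1 \<beta>2) \<circ>\<^sub>m act13 (R \<beta>1 \<beta>3) \<circ>\<^sub>m act23 (R \<beta>2 \<beta>3))"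
  (is "rational_eq _ ?F ?G")
proof -
  let ?b = "\<beta>1 - \<beta>2" and ?d = "\<beta>2 - \<beta>3"
  have "generic coords_triple (dom ?F)"
    by (rule generic_mono[OF generic_yang_baxter_factors[of ?b ?d]])
       (auto simp: dom_def yang_baxter_left)
  moreover have "generic coords_triple (dom ?G)"
    by (rule generic_mono[OF generic_yang_baxter_factors[of ?b ?d]])
       (auto simp: dom_def yang_baxter_right)
  moreover have "?F v = ?G v" if v: "v \<in> dom ?F \<inter> dom ?G" for v
  proof -
    obtain x1 x2 y1 y2 z1 z2 where v_eq: "v = ((x1, x2), (y1, y2), (z1, z2))"
      by (metis surj_pair)
    define A where "A = x1 - y2"
    define P where "P = (A + ?b) / A"
    define S where "S = (y1 - z2 + ?d) / (y1 - z2)"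
    define l where "l = left_num ?b ?d A y1 z2 / left_den ?b A y1 z2"
    define r where "r = right_num ?b ?d A y1 z2 / right_den ?d A y1 z2"
    note defs = A_def[symmetric] P_def[symmetric] S_def[symmetric] l_def[symmetric] r_def[symmetric]
    note F = yang_baxter_left[of \<beta>2 \<beta>3 \<beta>1 x1 x2 y1 y2 z1 z2, unfolded defs]
    note G = yang_baxter_right[of \<beta>1 \<beta>2 \<beta>3 x1 x2 y1 y2 z1 z2, unfolded defs]
    have nz: "A \<noteq> 0" "A + ?b \<noteq> 0" "left_den ?b A y1 z2 \<noteq> 0" "left_num ?b ?d A y1 z2 \<noteq> 0"
      "right_den ?d A y1 z2 \<noteq> 0" "right_num ?b ?d A y1 z2 \<noteq> 0"
      using v unfolding v_eq dom_def Int_iff mem_Collect_eq F by (auto split: if_splits)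
    have nz': "y1 - z2 \<noteq> 0" "y1 - z2 + ?d \<noteq> 0"
      using v unfolding v_eq dom_def Int_iff mem_Collect_eq G by (auto split: if_splits)
    have P: "P \<noteq> 0" and S: "S \<noteq> 0"
      using nz nz' by (auto simp: P_def S_def)
    have key: "(1 - l) * (r / P) = (1 - S) * r + S - l"
      by (rule additive_identity[OF nz(1,2) nz'(1) nz(3,5) P_def S_def l_def r_def])
    have left: "(y2 * P + z2 * (1 - l)) * (r / P) = y2 * r + z2 * ((1 - S) * r + S - l)"
    proof -
      have "(y2 * P + z2 * (1 - l)) * (r / P) = y2 * (P * (r / P)) + z2 * ((1 - l) * (r / P))"
        by (simp only: distrib_right mult.assoc)
      then show ?thesis
        unfolding key using P by simp
    qed
    have "S * (1 - l / S) = S - l"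
      using S by (simp add: right_diff_distrib)
    then have right: "z2 * S * (1 - l / S) = z2 * (S - l)"
      by (simp only: mult.assoc)
    have y: "(y2 * P + z2 * (1 - l)) * (r / P) =
        (y2 + z2 * (1 - S)) * r + z2 * S * (1 - l / S)"
      unfolding left right by (simp add: algebra_simps)
    \<comment> \<open>Since \<open>p\<^sup>2 + q\<^sup>2 = x\<^sup>2 + y\<^sup>2\<close>, the three second components have the same sum on both sides,
      so agreement in the last entry follows from agreement in the others.\<close>
    have "(y2 * P + z2 * (1 - l)) * (1 - r / P) =
        y2 * P + z2 * (1 - l) - (y2 * r + z2 * ((1 - S) * r + S - l))"
      unfolding left[symmetric] by (simp only: right_diff_distrib mult_1_right)
    then have z: "x2 + y2 * (1 - P) + (y2 * P + z2 * (1 - l)) * (1 - r / P) =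
        x2 + (y2 + z2 * (1 - S)) * (1 - r)"
      by (simp add: algebra_simps)
    show ?thesis
      unfolding v_eq F G y z using nz nz' by simp
  qed
  ultimately show ?thesis
    unfolding rational_eq_def by blast
qed

theorem mainTheorem2:
  fixes \<beta>1 \<beta>2 \<beta>3 :: complex
  shows "birational_map coords_pair coords_pair (R \<beta>1 \<beta>2)
    \<and> (\<forall>u v u1 u2 v2 u12 v12 :: complex.
         u \<noteq> 0 \<longrightarrow> u1 \<noteq> 0 \<longrightarrow> u12 \<noteq> 0 \<longrightarrow> 1 - u1 * v2 \<noteq> 0 \<longrightarrow>
         u12 = u + (\<beta>1 - \<beta>2) / (1 - u1 * v2) * u1 \<longrightarrow>
         v12 = v - (\<beta>1 - \<beta>2) / (1 - u1 * v2) * v2 \<longrightarrow>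
         R \<beta>1 \<beta>2 ((u / u1, v * u1), (u2 / u, u * v2)) =
           Some ((u2 / u12, v2 * u12), (u12 / u1, u1 * v12)))
    \<and> rational_eq coords_triple
         (act23 (R \<beta>2 \<beta>3) \<circ>\<^sub>m act13 (R \<beta>1 \<beta>3) \<circ>\<^sub>m act12 (R \<beta>1 \<beta>2))
         (act12 (R \<beta>1 \<beta>2) \<circ>\<^sub>m act13 (R \<beta>1 \<beta>3) \<circ>\<^sub>m act23 (R \<beta>2 \<beta>3))"
  using birational_map_R R_lattice yang_baxter_R by blast

end
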